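(* Let $\langle d,k,m\rangle\in M_n\setminus\{\mathbf{0}\}$. If $d=0$ then $\langle d,k,m\rangle$ is idempotent; if $d\ne 0$ then it is nilpotent, and its nilpotency index $\ell$ (the smallest $j\in\mathbb{N}$ with $\langle d,k,m\rangle^j=\mathbf{0}$) is $$\ell=1+\left\lceil\frac{m-k+1}{|d|}\right\rceil,$$ and satisfies $2\le\ell\le n$.
   Context: Fix an integer $n\ge 2$. For integers $d,k,m$ with $1-\min(0,d)\le k\le m\le n-\max(0,d)$, let $\langle d,k,m\rangle$ denote the $n\times n$ matrix with entries $x_{ij}$ ($i,j\in\{1,\dots,n\}$) equal to $1$ if $k\le i\le m$ and $j-i=d$, and $0$ otherwise (it has $m-k+1$ ones). Let $\mathbf{0}$ be the $n\times n$ zero matrix and $M_n=\{\mathbf{0}\}\cup\{\langle d,k,m\rangle: d\in\mathbb{Z},\ k,m\in\mathbb{N},\ 1-\min(0,d)\le k\le m\le n-\max(0,d)\}$, a monoid under matrix multiplication. $\lceil t\rceil$ is the ceiling of $t$. *)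

theory Defs
  imports Complex_Main "Jordan_Normal_Form.Matrix"
begin

definition diag_params :: "nat \<Rightarrow> int \<Rightarrow> nat \<Rightarrow> nat \<Rightarrow> bool" where
  "diag_params n d k m \<longleftrightarrow>
     1 - min 0 d \<le> int k \<and> k \<le> m \<and> int m \<le> int n - max 0 d"

text \<open>
  Matrices of type \<^typ>\<open>'a mat\<close> have row and column indices starting at 0, so the entry
  in row \<open>i\<close> and column \<open>j\<close> below is the entry with indices \<open>i + 1\<close> and \<open>j + 1\<close> in the
  numbering by \<open>1, \<dots>, n\<close>. The shift cancels in the condition \<open>j - i = d\<close>.
\<close>

definition diag_segment :: "nat \<Rightarrow> int \<Rightarrow> nat \<Rightarrow> nat \<Rightarrow> 'a :: semiring_1 mat" where
  "diag_segment n d k m =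
     mat n n (\<lambda>(i, j). if k \<le> i + 1 \<and> i + 1 \<le> m \<and> int j - int i = d then 1 else 0)"

definition diag_monoid :: "nat \<Rightarrow> 'a :: semiring_1 mat set" where
  "diag_monoid n = {0\<^sub>m n n} \<union> {diag_segment n d k m | d k m. diag_params n d k m}"

definition idempotent_mat :: "'a :: semiring_1 mat \<Rightarrow> bool" where
  "idempotent_mat A \<longleftrightarrow> A * A = A"

definition nilpotent_mat :: "'a :: semiring_1 mat \<Rightarrow> bool" where
  "nilpotent_mat A \<longleftrightarrow> (\<exists>j. A ^\<^sub>m j = 0\<^sub>m (dim_row A) (dim_col A))"

text \<open>
  The exponent 0 is harmless here and in \<^const>\<open>nilpotent_mat\<close>: the zeroth power is the
  identity matrix, which is nonzero as soon as there is at least one row.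
\<close>

definition nilpotency_index :: "'a :: semiring_1 mat \<Rightarrow> nat" where
  "nilpotency_index A = (LEAST j. A ^\<^sub>m j = 0\<^sub>m (dim_row A) (dim_col A))"

end

theory Submission
  imports Defs
begin

text \<open>
  \<open>\<langle>d, k, m\<rangle>\<close> is the partial translation \<open>i \<mapsto> i + d\<close> with domain \<open>{k..m}\<close>, and matrix products are
  compositions of partial translations. Hence each further factor \<open>\<langle>d, k, m\<rangle>\<close> cuts \<open>\<bar>d\<bar>\<close> points off
  one end of the domain: the upper end if \<open>d > 0\<close>, the lower end if \<open>d < 0\<close>. The power with
  exponent \<open>r + 1\<close> therefore vanishes exactly when \<open>m - k + 1 \<le> r * \<bar>d\<bar>\<close>.
\<close>

lemma ceiling_divide_le_iff:
  assumes "0 < q"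
  shows "\<lceil>of_int p / of_int q :: 'a :: floor_ceiling\<rceil> \<le> x \<longleftrightarrow> p \<le> x * q"
proof -
  have "\<lceil>of_int p / of_int q :: 'a\<rceil> \<le> x \<longleftrightarrow> (of_int p :: 'a) \<le> of_int (x * q)"
    using assms by (simp add: ceiling_le_iff pos_divide_le_eq)
  then show ?thesis
    by (simp only: of_int_le_iff)
qed

lemma of_nat_mult_same_sign:
  fixes d :: "'a :: linordered_idom"
  shows "0 \<le> d \<and> 0 \<le> of_nat r * d \<or> d \<le> 0 \<and> of_nat r * d \<le> 0"
  by (cases "0 \<le> d") (auto simp: mult_nonneg_nonpos)

lemma nilpotent_mat_if_pow_eq_zero_iff:
  assumes "\<And>j. A ^\<^sub>m j = 0\<^sub>m (dim_row A) (dim_col A) \<longleftrightarrow> l \<le> j"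
  shows "nilpotent_mat A" and "nilpotency_index A = l"
proof -
  show "nilpotent_mat A"
    using assms by (auto simp: nilpotent_mat_def)
  show "nilpotency_index A = l"
    unfolding nilpotency_index_def assms by (rule Least_equality) auto
qed

lemma diag_paramsD:
  assumes "diag_params n d k m"
  shows "1 \<le> k" and "k \<le> m" and "m \<le> n" and "int m - int k + 1 \<le> int n - \<bar>d\<bar>"
  using assms by (auto simp: diag_params_def)

lemma diag_segment_carrier: "diag_segment n d k m \<in> carrier_mat n n"
  by (simp add: diag_segment_def)

lemma dim_diag_segment [simp]:
  "dim_row (diag_segment n d k m) = n"
  "dim_col (diag_segment n d k m) = n"
  by (simp_all add: diag_segment_def)

lemma diag_segment_index:
  assumes "i < n" and "j < n"
  shows "diag_segment n d k m $$ (i, j) =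
    of_bool (k \<le> i + 1 \<and> i + 1 \<le> m \<and> int j = int i + d)"
  using assms by (auto simp: diag_segment_def)

lemma diag_segment_eq_zero:
  assumes "m < k"
  shows "diag_segment n d k m = 0\<^sub>m n n"
  using assms by (intro eq_matI) (auto simp: diag_segment_index)

lemma diag_segment_neq_zero:
  assumes "diag_params n d k m"
  shows "(diag_segment n d k m :: 'a :: semiring_1 mat) \<noteq> 0\<^sub>m n n"
proof
  assume zero: "(diag_segment n d k m :: 'a mat) = 0\<^sub>m n n"
  have "k - 1 < n" and "nat (int k - 1 + d) < n" and "int k - 1 + d \<ge> 0"
    using assms by (auto simp: diag_params_def)
  then have "(diag_segment n d k m :: 'a mat) $$ (k - 1, nat (int k - 1 + d)) = 1"
    using diag_paramsD[OF assms] by (simp add: diag_segment_index)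
  with zero show False
    using \<open>k - 1 < n\<close> \<open>nat (int k - 1 + d) < n\<close> by simp
qed

text \<open>
  The truncation in \<^const>\<open>nat\<close> is harmless: row numbers start at 1, so a lower end truncated
  to 0 does not restrict the domain, and an upper end truncated to 0 empties it.
\<close>

lemma diag_segment_mult:
  assumes "1 \<le> k'" and "m' \<le> n"
  shows "(diag_segment n d k m :: 'a :: semiring_1 mat) * diag_segment n d' k' m' =
    diag_segment n (d + d') (max k (nat (int k' - d))) (min m (nat (int m' - d)))"
    (is "?A * ?B = ?C")
proof (rule eq_matI)
  fix i j
  assume "i < dim_row ?C" and "j < dim_col ?C"
  then have "i < n" and "j < n"
    by simp_all
  define composable where "composable \<longleftrightarrow> k \<le> i + 1 \<and> i + 1 \<le> m \<and>
    int k' \<le> int i + d + 1 \<and> int i + d + 1 \<le> int m' \<and> int j = int i + d + d'"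
  have composable_iff: "(k \<le> i + 1 \<and> i + 1 \<le> m \<and> int l = int i + d) \<and>
      (k' \<le> l + 1 \<and> l + 1 \<le> m' \<and> int j = int l + d') \<longleftrightarrow>
      l = nat (int i + d) \<and> composable" for l
    unfolding composable_def using assms(1) by linarith
  have entry_mult: "?A $$ (i, l) * ?B $$ (l, j) = of_bool (l = nat (int i + d) \<and> composable)"
    if "l < n" for l
    unfolding diag_segment_index[OF \<open>i < n\<close> that] diag_segment_index[OF that \<open>j < n\<close>]
      of_bool_conj[symmetric] composable_iff ..
  have "(?A * ?B) $$ (i, j) = (\<Sum>l<n. ?A $$ (i, l) * ?B $$ (l, j))"
    using \<open>i < n\<close> \<open>j < n\<close> by (simp add: scalar_prod_def lessThan_atLeast0)
  also have "\<dots> = (\<Sum>l<n. if l = nat (int i + d) then of_bool composable else 0)"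
    by (intro sum.cong) (simp_all add: entry_mult)
  also have "\<dots> = of_bool composable"
  proof -
    have "nat (int i + d) < n" if composable
      using that assms by (auto simp: composable_def)
    then show ?thesis
      by auto
  qed
  also have "composable \<longleftrightarrow> max k (nat (int k' - d)) \<le> i + 1 \<and>
      i + 1 \<le> min m (nat (int m' - d)) \<and> int j = int i + (d + d')"
    unfolding composable_def by auto
  also have "of_bool \<dots> = ?C $$ (i, j)"
    by (rule diag_segment_index[OF \<open>i < n\<close> \<open>j < n\<close>, symmetric])
  finally show "(?A * ?B) $$ (i, j) = ?C $$ (i, j)" .
qed simp_all

lemma diag_segment_pow_Suc:
  assumes "1 \<le> k" and "m \<le> n"
  shows "(diag_segment n d k m :: 'a :: semiring_1 mat) ^\<^sub>m Suc r =
    diag_segment n (int (Suc r) * d)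
      (max k (nat (int k - int r * d))) (min m (nat (int m - int r * d)))"
proof (induction r)
  case 0
  then show ?case
    using left_mult_one_mat[OF diag_segment_carrier] by simp
next
  case (Suc r)
  let ?A = "diag_segment n d k m :: 'a mat"
  let ?k = "\<lambda>r. max k (nat (int k - int r * d))" and ?m = "\<lambda>r. min m (nat (int m - int r * d))"
  have Suc_mult: "int (Suc s) * d = int s * d + d" for s
    by (simp add: algebra_simps)
  have lower: "max (?k r) (nat (int k - int (Suc r) * d)) = ?k (Suc r)"
    and upper: "min (?m r) (nat (int m - int (Suc r) * d)) = ?m (Suc r)"
    unfolding Suc_mult using of_nat_mult_same_sign[of d r] by linarith+
  have "?A ^\<^sub>m Suc (Suc r) = diag_segment n (int (Suc r) * d) (?k r) (?m r) * ?A"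
    by (simp only: pow_mat.simps(2)[of _ "Suc r"] Suc.IH)
  also have "\<dots> = diag_segment n (int (Suc r) * d + d)
      (max (?k r) (nat (int k - int (Suc r) * d))) (min (?m r) (nat (int m - int (Suc r) * d)))"
    by (rule diag_segment_mult[OF assms])
  finally show ?case
    unfolding lower upper Suc_mult[of "Suc r"] .
qed

lemma diag_segment_pow_Suc_eq_zero_iff:
  assumes "diag_params n d k m"
  shows "(diag_segment n d k m :: 'a :: semiring_1 mat) ^\<^sub>m Suc r = 0\<^sub>m n n \<longleftrightarrow>
    int m - int k + 1 \<le> int r * \<bar>d\<bar>"
proof -
  let ?k = "max k (nat (int k - int r * d))" and ?m = "min m (nat (int m - int r * d))"
  note params = diag_paramsD[OF assms]
  have pow: "(diag_segment n d k m :: 'a mat) ^\<^sub>m Suc r = diag_segment n (int (Suc r) * d) ?k ?m"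
    using params by (intro diag_segment_pow_Suc)
  have "int r * \<bar>d\<bar> = \<bar>int r * d\<bar>"
    by (simp add: abs_mult)
  then have exhausted_iff: "?m < ?k \<longleftrightarrow> int m - int k + 1 \<le> int r * \<bar>d\<bar>"
    using params by linarith
  have "diag_params n (int (Suc r) * d) ?k ?m" if "?k \<le> ?m"
    using that assms of_nat_mult_same_sign[of d r]
    unfolding diag_params_def by (auto simp: algebra_simps)
  then show ?thesis
    unfolding pow exhausted_iff[symmetric]
    using diag_segment_eq_zero diag_segment_neq_zero by (meson not_less)
qed

lemma diag_segment_pow_eq_zero_iff:
  assumes "diag_params n d k m"
  shows "(diag_segment n d k m :: 'a :: semiring_1 mat) ^\<^sub>m j = 0\<^sub>m n n \<longleftrightarrow>
    int m - int k + 1 \<le> (int j - 1) * \<bar>d\<bar>"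
proof (cases j)
  case 0
  have "0 < n" and "k \<le> m"
    using diag_paramsD[OF assms] by simp_all
  then have "(1\<^sub>m n :: 'a mat) $$ (0, 0) \<noteq> 0\<^sub>m n n $$ (0, 0)"
    by simp
  then show ?thesis
    using 0 \<open>k \<le> m\<close> by auto
next
  case (Suc r)
  then show ?thesis
    using diag_segment_pow_Suc_eq_zero_iff[OF assms, of r] by simp
qed

definition exhausting_cuts :: "int \<Rightarrow> nat \<Rightarrow> nat \<Rightarrow> int" where
  "exhausting_cuts d k m = \<lceil>(real m - real k + 1) / real_of_int \<bar>d\<bar>\<rceil>"

lemma exhausting_cuts_le_iff:
  assumes "d \<noteq> 0"
  shows "exhausting_cuts d k m \<le> x \<longleftrightarrow> int m - int k + 1 \<le> x * \<bar>d\<bar>"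
  using ceiling_divide_le_iff[of "\<bar>d\<bar>" "int m - int k + 1" x, where ?'a = real] assms
  by (simp add: exhausting_cuts_def)

lemma exhausting_cuts_bounds:
  assumes "diag_params n d k m" and "d \<noteq> 0"
  shows "1 \<le> exhausting_cuts d k m" and "exhausting_cuts d k m \<le> int n - 1"
proof -
  note params = diag_paramsD[OF assms(1)]
  show "1 \<le> exhausting_cuts d k m"
    using params assms(2) by (simp add: exhausting_cuts_def)
  have "int m - int k + 1 \<le> int n - \<bar>d\<bar>"
    using params by simp
  also have "\<dots> \<le> int n * \<bar>d\<bar> - \<bar>d\<bar>"
    using assms(2) mult_left_mono[of 1 "\<bar>d\<bar>" "int n"] by simp
  also have "\<dots> = (int n - 1) * \<bar>d\<bar>"
    by (simp only: left_diff_distrib mult_1)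
  finally show "exhausting_cuts d k m \<le> int n - 1"
    using exhausting_cuts_le_iff[OF assms(2)] by blast
qed

lemma idempotent_diag_segment_zero:
  assumes "1 \<le> k" and "m \<le> n"
  shows "idempotent_mat (diag_segment n 0 k m)"
  using assms by (simp add: idempotent_mat_def diag_segment_mult)

lemma nilpotent_diag_segment:
  assumes "diag_params n d k m" and "d \<noteq> 0"
  shows "nilpotent_mat (diag_segment n d k m :: 'a :: semiring_1 mat)"
    and "int (nilpotency_index (diag_segment n d k m :: 'a mat)) = 1 + exhausting_cuts d k m"
proof -
  let ?A = "diag_segment n d k m :: 'a mat"
  have pow_zero_iff: "?A ^\<^sub>m j = 0\<^sub>m (dim_row ?A) (dim_col ?A) \<longleftrightarrow>
      nat (1 + exhausting_cuts d k m) \<le> j" for j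
  proof -
    have "?A ^\<^sub>m j = 0\<^sub>m n n \<longleftrightarrow> int m - int k + 1 \<le> (int j - 1) * \<bar>d\<bar>"
      by (rule diag_segment_pow_eq_zero_iff[OF assms(1)])
    also have "\<dots> \<longleftrightarrow> exhausting_cuts d k m \<le> int j - 1"
      by (rule exhausting_cuts_le_iff[OF assms(2), symmetric])
    finally show ?thesis by auto
  qed
  show "nilpotent_mat ?A"
    using pow_zero_iff by (rule nilpotent_mat_if_pow_eq_zero_iff(1))
  have "nilpotency_index ?A = nat (1 + exhausting_cuts d k m)"
    using pow_zero_iff by (rule nilpotent_mat_if_pow_eq_zero_iff(2))
  then show "int (nilpotency_index ?A) = 1 + exhausting_cuts d k m"
    using exhausting_cuts_bounds(1)[OF assms] by simp
qed

theorem theorem4: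
  fixes n k m :: nat and d :: int and A :: "'a :: semiring_1 mat"
  assumes "n \<ge> 2"
    and "diag_params n d k m"
    and "A = diag_segment n d k m"
    and "A \<in> diag_monoid n - {0\<^sub>m n n}"
  shows "(d = 0 \<longrightarrow> idempotent_mat A) \<and>
         (d \<noteq> 0 \<longrightarrow>
            nilpotent_mat A \<and>
            int (nilpotency_index A) = 1 + \<lceil>(real m - real k + 1) / real_of_int \<bar>d\<bar>\<rceil> \<and>
            2 \<le> nilpotency_index A \<and> nilpotency_index A \<le> n)"
proof (intro conjI[of "d = 0 \<longrightarrow> _"] impI)
  assume "d = 0"
  then show "idempotent_mat A"
    using diag_paramsD[OF assms(2)] assms(3) by (simp add: idempotent_diag_segment_zero)
next
  assume "d \<noteq> 0"
  note nilpotent = nilpotent_diag_segment[OF assms(2) \<open>d \<noteq> 0\<close>, where ?'a = 'a, folded assms(3)]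
  moreover have "2 \<le> nilpotency_index A" and "nilpotency_index A \<le> n"
    using nilpotent(2) exhausting_cuts_bounds[OF assms(2) \<open>d \<noteq> 0\<close>] by linarith+
  ultimately show "nilpotent_mat A \<and>
      int (nilpotency_index A) = 1 + \<lceil>(real m - real k + 1) / real_of_int \<bar>d\<bar>\<rceil> \<and>
      2 \<le> nilpotency_index A \<and> nilpotency_index A \<le> n"
    by (simp add: exhausting_cuts_def)
qed

end
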